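(* In the setting described in the context, the following optimization problem (Problem 2, best selection) is concave, i.e. it is the maximization of a concave function of $(p_1,\dots,p_N)$ under linear constraints: $$\max_{p_1,\dots,p_N}\ \sum_{i=1}^{N}q_i\left\{1-\exp\left(-\lambda p_i\pi D^2\sum_{m=1}^{M-L+1}(-1)^{m+1}\binom{M-L+1}{m}\int_0^D e^{-\frac{\eta\beta m y^{\alpha_i}}{P}\sigma^2}\mathcal{L}_{\mathcal{I}_o}\!\left(\frac{\eta\beta m y^{\alpha_i}}{P}\right)\frac{2y}{D^2}\,\mathrm{d}y\right)\right\}$$ subject to $\sum_{i=1}^N p_i\le N_c$ and $0\le p_i\le 1$ for all $i=1,\dots,N$.
   Context: Parameters: integers $M\ge1$, $N>N_c\ge 1$; reals $\lambda,\lambda_p,D,P,\beta>0$, $\sigma^2\ge0$, $d_g\ge 0$, pathloss exponents $0<\alpha_i<\alpha_o$ (the subscript in $\alpha_i$ is a label, unrelated to the file index $i$); a probability vector $q_1\ge\dots\ge q_N\ge 0$, $\sum_i q_i=1$. Here $p_i$ is the probability that a radio unit (RU) caches file $i$, $q_i$ the request probability of file $i$, $N_c$ the cache memory size. $L=\min\{M,\lfloor\lambda\pi D^2\rfloor\}$ and $\eta=\bigl((M-L+1)!\bigr)^{-1/(M-L+1)}$. $\mathcal{L}_{\mathcal{I}_o}(s)=\mathbb{E}\{e^{-s\mathcal{I}_o}\}$ is the Laplace transform of the nonnegative random variable $$\mathcal{I}_o=\sum_{\mathbf{x}\in\Phi_p}\sum_{\mathbf{y}\in\mathcal{A}_{\mathbf{x}}}P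 f_{\mathbf{y}}\|\mathbf{y}\|^{-\alpha_o},$$ the out of cloud interference: $\Phi_p$ is a homogeneous Poisson point process on $\mathbb{R}^2$ of intensity $\lambda_p$; given $\Phi_p$, for each $\mathbf{x}\in\Phi_p$, $\Phi_{\mathbf{x}}$ is an independent homogeneous Poisson point process of intensity $\lambda$ on the disk of center $\mathbf{x}$ and radius $D$; $\mathcal{A}_{\mathbf{x}}$ consists of $\min\{M,n\}$ of the $n$ points of $\Phi_{\mathbf{x}}$ at distance more than $d_g$ from the origin, chosen uniformly at random; the $f_{\mathbf{y}}$ are i.i.d. unit-mean exponential, independent of the locations. *)

theory Defs
  imports "HOL-Probability.Probability"
begin

text \<open>
  A point process is a random set of points. The Poisson law is written out because
  \<open>poisson_pmf\<close> requires a positive rate, whereas \<open>S \<inter> B\<close> may be a null set here.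
\<close>

definition (in prob_space) homogeneous_ppp ::
    "real \<Rightarrow> 'b::euclidean_space set \<Rightarrow> ('a \<Rightarrow> 'b set) \<Rightarrow> bool" where
  "homogeneous_ppp \<mu> S \<Phi> \<longleftrightarrow>
     (\<forall>\<omega>\<in>space M. \<Phi> \<omega> \<subseteq> S \<and> (\<forall>B. bounded B \<longrightarrow> finite (\<Phi> \<omega> \<inter> B))) \<and>
     (\<forall>B\<in>sets borel. bounded B \<longrightarrow>
        random_variable (count_space UNIV) (\<lambda>\<omega>. card (\<Phi> \<omega> \<inter> B)) \<and>
        (\<forall>k. prob {\<omega>\<in>space M. card (\<Phi> \<omega> \<inter> B) = k} =
               (\<mu> * measure lborel (S \<inter> B)) ^ k / fact k * exp (- (\<mu> * measure lborel (S \<inter> B))))) \<and>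
     (\<forall>(B :: nat \<Rightarrow> 'b set) I. finite I \<longrightarrow> disjoint_family_on B I \<longrightarrow>
        (\<forall>i\<in>I. B i \<in> sets borel \<and> bounded (B i)) \<longrightarrow>
        indep_vars (\<lambda>_. count_space UNIV) (\<lambda>i \<omega>. card (\<Phi> \<omega> \<inter> B i)) I)"

text \<open>
  Independence of two random elements with values in different types (\<open>indep_var\<close>
  forces both to have the same type).
\<close>

definition (in prob_space) indep_elements ::
    "'b measure \<Rightarrow> ('a \<Rightarrow> 'b) \<Rightarrow> 'c measure \<Rightarrow> ('a \<Rightarrow> 'c) \<Rightarrow> bool" where
  "indep_elements N X N' Y \<longleftrightarrow>
     random_variable N X \<and> random_variable N' Y \<and>
     indep_set (sets (vimage_algebra (space M) X N)) (sets (vimage_algebra (space M) Y N'))"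

text \<open>
  Enumerated encoding of the parent-offspring process: the parents are \<open>X 0, X 1, \<dots>\<close>; the
  cluster of \<open>X k\<close> consists of the \<open>n k\<close> points \<open>X k + Z k j\<close> with \<open>j < n k\<close>. The values of
  \<open>Z k j\<close> for \<open>j \<ge> n k\<close> are not points of the process.
\<close>

abbreviation parent_space :: "(nat \<Rightarrow> real ^ 2) measure" where
  "parent_space \<equiv> PiM UNIV (\<lambda>_. borel)"

abbreviation cluster_space :: "(nat \<times> (nat \<Rightarrow> real ^ 2)) measure" where
  "cluster_space \<equiv> count_space UNIV \<Otimes>\<^sub>M PiM UNIV (\<lambda>_. borel)"

abbreviation location_space ::
    "((nat \<Rightarrow> real ^ 2) \<times> (nat \<Rightarrow> nat \<times> (nat \<Rightarrow> real ^ 2))) measure" where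
  "location_space \<equiv> parent_space \<Otimes>\<^sub>M PiM UNIV (\<lambda>_. cluster_space)"

abbreviation selection_space :: "(nat \<Rightarrow> nat set) measure" where
  "selection_space \<equiv> PiM UNIV (\<lambda>_. count_space {T. finite T})"

definition parents :: "(nat \<Rightarrow> 'w \<Rightarrow> real ^ 2) \<Rightarrow> 'w \<Rightarrow> nat \<Rightarrow> real ^ 2" where
  "parents X \<omega> = (\<lambda>k. X k \<omega>)"

definition cluster ::
    "(nat \<Rightarrow> 'w \<Rightarrow> nat) \<Rightarrow> (nat \<Rightarrow> nat \<Rightarrow> 'w \<Rightarrow> real ^ 2) \<Rightarrow> nat \<Rightarrow> 'w \<Rightarrow> nat \<times> (nat \<Rightarrow> real ^ 2)" where
  "cluster n Z k \<omega> = (n k \<omega>, \<lambda>j. Z k j \<omega>)"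

definition locations ::
    "(nat \<Rightarrow> 'w \<Rightarrow> real ^ 2) \<Rightarrow> (nat \<Rightarrow> 'w \<Rightarrow> nat) \<Rightarrow> (nat \<Rightarrow> nat \<Rightarrow> 'w \<Rightarrow> real ^ 2) \<Rightarrow> 'w \<Rightarrow>
       (nat \<Rightarrow> real ^ 2) \<times> (nat \<Rightarrow> nat \<times> (nat \<Rightarrow> real ^ 2))" where
  "locations X n Z \<omega> = (parents X \<omega>, \<lambda>k. cluster n Z k \<omega>)"

definition eligible ::
    "real \<Rightarrow> (nat \<Rightarrow> 'w \<Rightarrow> real ^ 2) \<Rightarrow> (nat \<Rightarrow> 'w \<Rightarrow> nat) \<Rightarrow> (nat \<Rightarrow> nat \<Rightarrow> 'w \<Rightarrow> real ^ 2) \<Rightarrow>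
       nat \<Rightarrow> 'w \<Rightarrow> nat set" where
  "eligible d_g X n Z k \<omega> = {j. j < n k \<omega> \<and> norm (X k \<omega> + Z k j \<omega>) > d_g}"

definition selections :: "nat \<Rightarrow> nat set \<Rightarrow> nat set set" where
  "selections M E = {T. T \<subseteq> E \<and> card T = min M (card E)}"

text \<open>
  \<open>A k \<omega>\<close> is the set of indices of the active points of cluster \<open>k\<close>, and \<open>f (k, j)\<close> is the
  fading of its point \<open>j\<close>. Since the offsets \<open>Z\<close> are independent of the parents, the clusters
  are, given the parents, independent Poisson processes on the disks centered at the parents.
  The assumption \<open>selection\<close> says that conditionally on all locations the sets \<open>A k\<close> are
  independent and uniformly distributed on the admissible selections.
\<close>

locale cluster_network = prob_space \<Omega> for \<Omega> :: "'w measure" +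
  fixes lam_p lam D d_g :: real and M :: nat
    and X :: "nat \<Rightarrow> 'w \<Rightarrow> real ^ 2"
    and n :: "nat \<Rightarrow> 'w \<Rightarrow> nat"
    and Z :: "nat \<Rightarrow> nat \<Rightarrow> 'w \<Rightarrow> real ^ 2"
    and A :: "nat \<Rightarrow> 'w \<Rightarrow> nat set"
    and f :: "nat \<times> nat \<Rightarrow> 'w \<Rightarrow> real"
  assumes parents_distinct: "\<omega> \<in> space \<Omega> \<Longrightarrow> inj (\<lambda>k. X k \<omega>)"
    and parents_ppp: "homogeneous_ppp lam_p UNIV (\<lambda>\<omega>. range (\<lambda>k. X k \<omega>))"
    and offsets_distinct: "\<omega> \<in> space \<Omega> \<Longrightarrow> inj_on (\<lambda>j. Z k j \<omega>) {..<n k \<omega>}"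
    and offsets_ppp: "homogeneous_ppp lam (cball 0 D) (\<lambda>\<omega>. (\<lambda>j. Z k j \<omega>) ` {..<n k \<omega>})"
    and clusters_indep: "indep_vars (\<lambda>_. cluster_space) (cluster n Z) UNIV"
    and parents_clusters_indep:
      "indep_elements parent_space (parents X)
         (PiM UNIV (\<lambda>_. cluster_space)) (\<lambda>\<omega> k. cluster n Z k \<omega>)"
    and selection_measurable: "random_variable (count_space {T. finite T}) (A k)"
    and selection:
      "\<lbrakk>G \<in> sets location_space; finite K\<rbrakk> \<Longrightarrow>
         prob {\<omega>\<in>space \<Omega>. locations X n Z \<omega> \<in> G \<and> (\<forall>k\<in>K. A k \<omega> = T k)} =
         expectation (\<lambda>\<omega>. indicator G (locations X n Z \<omega>) *
           (\<Prod>k\<in>K. pmf (pmf_of_set (selections M (eligible d_g X n Z k \<omega>))) (T k)))"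
    and fading_indep: "indep_vars (\<lambda>_. borel) f UNIV"
    and fading_exponential: "distributed \<Omega> lborel (f kj) (exponential_density 1)"
    and fading_locations_indep:
      "indep_elements (PiM UNIV (\<lambda>_. borel)) (\<lambda>\<omega> kj. f kj \<omega>)
         (location_space \<Otimes>\<^sub>M selection_space) (\<lambda>\<omega>. (locations X n Z \<omega>, \<lambda>k. A k \<omega>))"

text \<open>Extended values: the series may diverge, for instance almost surely if \<open>\<alpha>\<^sub>o \<le> 2\<close>.\<close>

definition interference ::
    "real \<Rightarrow> real \<Rightarrow> (nat \<Rightarrow> 'w \<Rightarrow> real ^ 2) \<Rightarrow> (nat \<Rightarrow> nat \<Rightarrow> 'w \<Rightarrow> real ^ 2) \<Rightarrow>
       (nat \<Rightarrow> 'w \<Rightarrow> nat set) \<Rightarrow> (nat \<times> nat \<Rightarrow> 'w \<Rightarrow> real) \<Rightarrow> 'w \<Rightarrow> ennreal" where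
  "interference P \<alpha>\<^sub>o X Z A f \<omega> =
     (\<Sum>k. \<Sum>j\<in>A k \<omega>. ennreal (P * f (k, j) \<omega> * norm (X k \<omega> + Z k j \<omega>) powr (- \<alpha>\<^sub>o)))"

text \<open>Convention: \<open>exp (- s * \<infinity>) = 0\<close>.\<close>

definition laplace_transform :: "'w measure \<Rightarrow> ('w \<Rightarrow> ennreal) \<Rightarrow> real \<Rightarrow> real" where
  "laplace_transform \<Omega> I s =
     (\<integral>\<omega>. (if I \<omega> = \<infinity> then 0 else exp (- s * enn2real (I \<omega>))) \<partial>\<Omega>)"

end

theory Submission
  imports Defs
begin

text \<open>
  The alternating sum of integrals does not depend on \<open>p\<close>, so every exponent is linear in
  \<open>p\<close>, and \<open>1 - exp\<close> of a linear function is concave whatever the sign of that sum.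
\<close>

text \<open>A linear \<open>g\<close> commutes with convex combinations, so only convexity of
  \<open>exp\<close> on the real line at \<open>g x\<close> and \<open>g y\<close> remains.\<close>

lemma convex_on_exp_linear:
  fixes g :: "'a::real_vector \<Rightarrow> real"
  assumes "linear g"
  shows "convex_on UNIV (\<lambda>x. exp (g x))"
proof (rule convex_onI)
  fix t :: real and x y :: 'a
  assume t: "0 < t" "t < 1"
  have "g ((1 - t) *\<^sub>R x + t *\<^sub>R y) = (1 - t) *\<^sub>R g x + t *\<^sub>R g y"
    using assms by (simp add: linear_add linear_scale)
  moreover have "exp ((1 - t) *\<^sub>R g x + t *\<^sub>R g y) \<le> (1 - t) * exp (g x) + t * exp (g y)"
    using convex_onD[OF exp_convex, of t "g x" "g y"] t by simp
  ultimately show "exp (g ((1 - t) *\<^sub>R x + t *\<^sub>R y)) \<le> (1 - t) * exp (g x) + t * exp (g y)"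
    by simp
qed simp

lemma concave_on_sum_of:
  assumes "convex S" and "\<And>i. i \<in> I \<Longrightarrow> concave_on S (h i)"
  shows "concave_on S (\<lambda>x. \<Sum>i\<in>I. h i x)"
  using assms(2)
proof (induction I rule: infinite_finite_induct)
  case (insert i I)
  then show ?case
    by (simp add: concave_on_add)
\<comment> \<open>For empty or infinite \<open>I\<close> the sum is the constant 0, which is concave
  on \<open>S\<close> because \<open>S\<close> is convex.\<close>
qed (use assms(1) in \<open>simp_all add: concave_on_const\<close>)

text \<open>Scaling a coordinate by \<open>c\<close> is linear, and nonnegative weights preserve
  concavity. The constant \<open>c\<close> stands for all factors of the exponent other than
  \<open>p $ i\<close>.\<close>

lemma concave_on_weighted_sum_one_minus_exp:
  fixes q :: "real ^ 'n"
  assumes "\<And>i. q $ i \<ge> 0"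
  shows "concave_on UNIV (\<lambda>p :: real ^ 'n. \<Sum>i\<in>UNIV. q $ i * (1 - exp (c * p $ i)))"
proof (rule concave_on_sum_of)
  fix i
  have "convex_on UNIV (\<lambda>p :: real ^ 'n. exp (c * p $ i))"
    by (rule convex_on_exp_linear) (auto intro!: linearI simp: algebra_simps)
  then show "concave_on UNIV (\<lambda>p :: real ^ 'n. q $ i * (1 - exp (c * p $ i)))"
    by (intro concave_on_cmul assms concave_on_diff) (simp_all add: concave_on_const)
qed simp

lemma polyhedron_capped_simplex:
  "polyhedron {p :: real ^ 'n. (\<Sum>i\<in>UNIV. p $ i) \<le> r \<and> (\<forall>i. a \<le> p $ i \<and> p $ i \<le> b)}"
proof -
  \<comment> \<open>The all-ones vector is the normal of the budget constraint,
    \<open>axis i 1\<close> that of the two bounds on coordinate \<open>i\<close>.\<close>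
  have "{p :: real ^ 'n. (\<Sum>i\<in>UNIV. p $ i) \<le> r \<and> (\<forall>i. a \<le> p $ i \<and> p $ i \<le> b)} =
      {p. (\<chi> i. 1) \<bullet> p \<le> r} \<inter> \<Inter> (range (\<lambda>i. {p. axis i 1 \<bullet> p \<ge> a} \<inter> {p. axis i 1 \<bullet> p \<le> b}))"
    by (auto simp: inner_vec_def[of "\<chi> i. 1"] inner_axis')
  moreover have "polyhedron \<dots>"
    \<comment> \<open>The intersection over coordinates is finite because the index type is.\<close>
    by (intro polyhedron_Int polyhedron_Inter)
      (auto intro!: polyhedron_Int polyhedron_halfspace_le polyhedron_halfspace_ge)
  ultimately show ?thesis
    by simp
qed

text \<open>Linearity of the constraints is expressed by the feasible set being a polyhedron.
  Concavity on the whole space restricts to this convex set.\<close>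

theorem theorem4:
  fixes \<Omega> :: "'w measure"
    and lam lam_p D P \<beta> \<sigma>2 d_g \<alpha>\<^sub>i \<alpha>\<^sub>o \<eta> :: real
    and M N\<^sub>c L :: nat
    and q :: "real ^ 'n::{finite,linorder}"
    and X :: "nat \<Rightarrow> 'w \<Rightarrow> real ^ 2"
    and n :: "nat \<Rightarrow> 'w \<Rightarrow> nat"
    and Z :: "nat \<Rightarrow> nat \<Rightarrow> 'w \<Rightarrow> real ^ 2"
    and A :: "nat \<Rightarrow> 'w \<Rightarrow> nat set"
    and f :: "nat \<times> nat \<Rightarrow> 'w \<Rightarrow> real"
    and \<L> :: "real \<Rightarrow> real"
  assumes "M \<ge> 1" and "N\<^sub>c \<ge> 1" and "CARD('n) > N\<^sub>c"
    and "lam > 0" and "lam_p > 0" and "D > 0" and "P > 0" and "\<beta> > 0"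
    and "\<sigma>2 \<ge> 0" and "d_g \<ge> 0" and "0 < \<alpha>\<^sub>i" and "\<alpha>\<^sub>i < \<alpha>\<^sub>o"
    and "\<And>i j. i \<le> j \<Longrightarrow> q $ j \<le> q $ i" and "\<And>i. q $ i \<ge> 0" and "(\<Sum>i\<in>UNIV. q $ i) = 1"
    and "L = min M (nat \<lfloor>lam * pi * D\<^sup>2\<rfloor>)"
    and "\<eta> = fact (M - L + 1) powr (- 1 / real (M - L + 1))"
    and "cluster_network \<Omega> lam_p lam D d_g M X n Z A f"
    and "\<L> = laplace_transform \<Omega> (interference P \<alpha>\<^sub>o X Z A f)"
  shows "polyhedron {p :: (real, 'n) vec. (\<Sum>i\<in>UNIV. p $ i) \<le> real N\<^sub>c \<and> (\<forall>i. 0 \<le> p $ i \<and> p $ i \<le> 1)}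
    \<and> concave_on UNIV (\<lambda>p :: (real, 'n) vec. \<Sum>i\<in>UNIV. q $ i *
        (1 - exp (- lam * p $ i * pi * D\<^sup>2 *
          (\<Sum>m = 1..M - L + 1. (- 1) ^ (m + 1) * real ((M - L + 1) choose m) *
            (LBINT y:{0..D}. exp (- (\<eta> * \<beta> * real m * y powr \<alpha>\<^sub>i / P) * \<sigma>2) *
               \<L> (\<eta> * \<beta> * real m * y powr \<alpha>\<^sub>i / P) * (2 * y / D\<^sup>2))))))"
proof (intro conjI)
  let ?S = "\<Sum>m = 1..M - L + 1. (- 1) ^ (m + 1) * real ((M - L + 1) choose m) *
    (LBINT y:{0..D}. exp (- (\<eta> * \<beta> * real m * y powr \<alpha>\<^sub>i / P) * \<sigma>2) *
       \<L> (\<eta> * \<beta> * real m * y powr \<alpha>\<^sub>i / P) * (2 * y / D\<^sup>2))"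
  \<comment> \<open>Moving \<open>p $ i\<close> to the end gives the exponent the shape
    \<open>c * p $ i\<close>, with \<open>c\<close> equal to
    \<open>- lam * pi * D\<^sup>2 * ?S\<close>.\<close>
  have eq: "- lam * x * pi * D\<^sup>2 * s = (- lam * pi * D\<^sup>2 * s) * x" for x s
    by (simp only: mult_ac)
  show "concave_on UNIV (\<lambda>p :: (real, 'n) vec. \<Sum>i\<in>UNIV. q $ i *
      (1 - exp (- lam * p $ i * pi * D\<^sup>2 * ?S)))"
    unfolding eq by (rule concave_on_weighted_sum_one_minus_exp) (rule assms(14))
qed (rule polyhedron_capped_simplex)

end
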